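(* Let $N\ge 2$ be an integer, let $\{(t_n,x_n): n=0,1,\dots,N\}\subset\mathbb{R}^2$ be a data set with $t_0<t_1<\dots<t_N$, and put $I=[t_0,t_N]$ and $I_n=[t_{n-1},t_n]$ for $n=1,\dots,N$. Let the data set be given with an iterated function system $\{(L_n(t),F_n(t,x)): n=1,\dots,N\}$, where for each $n=1,\dots,N$ the map $L_n:I\to I_n$ is a contractive homeomorphism with $L_n(t_0)=t_{n-1}$ and $L_n(t_N)=t_n$, and $F_n:I\times\mathbb{R}\to\mathbb{R}$ is given by $F_n(t,x)=\alpha_n x+q_n(t)$ with $\alpha_n\in(-1,1)$ and $q_n(t)=q_{n1}t+q_{n0}$, the real constants $q_{n1},q_{n0}$ being determined by the end point conditions $F_n(t_0,x_0)=x_{n-1}$ and $F_n(t_N,x_N)=x_n$. Let $f:I\to\mathbb{R}$ be the fractal interpolation function corresponding to this data set (and this iterated function system). Then $f$ satisfies the recursive relation $$f(t)=g_0(t)+\alpha_n\,(f-r)\circ L_n^{-1}(t)\qquad\text{for } t\in I_n,\ n=1,\dots,N,$$ where $g_0$ is the piecewise linear function through the points $(t_n,x_n)$, $n=0,1,\dots,N$, and $r$ is the line passing through $(t_0,x_0)$ and $(t_N,x_N)$. Moreover, the functions $g_0$ and $q_n$ are related by $$q_n\circ L_n^{-1}(t)=g_0(t)-\alpha_n\, r\circ L_n^{-1}(t)\qquad\text{for } t\in I_n,\ n=1,\dots,N.$$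
   Context: The fractal interpolation function associated with the system is the unique fixed point of the operator $T$ given by $(Tf)(t)=F_n\bigl(L_n^{-1}(t),f(L_n^{-1}(t))\bigr)$ for $t\in I_n$, $n=1,\dots,N$, acting on the set of continuous functions $f:I\to\mathbb{R}$ with $f(t_0)=x_0$ and $f(t_N)=x_N$, equipped with the supremum metric. The piecewise linear function through the points $(t_n,x_n)$ is the continuous function on $I$ that is linear (of the form $at+b$) on each $I_n$ and takes the value $x_n$ at $t_n$ for $n=0,\dots,N$. The line $r$ is regarded as the function of $t$ of the form $at+b$ with $r(t_0)=x_0$ and $r(t_N)=x_N$.
   Formalization: Each L_n is additionally assumed to be of the form at+b on I; for a general contractive homeomorphism the claim fails, e.g. N=2, t=(0,1,2), x=(0,1,0), all α_n=0, L_1(s)=s²/8+s/4, L_2(s)=1+s/2, at t=3/8. *)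

theory Defs
  imports "HOL-Analysis.Analysis"
begin

text \<open>
  Data are indexed by \<open>t x :: nat \<Rightarrow> real\<close>, only the values at \<open>0, \<dots>, N\<close> being relevant; families
  indexed by \<open>n = 1, \<dots>, N\<close> are functions on \<open>nat\<close> whose remaining values are irrelevant.
\<close>

definition linear_form_on :: "real set \<Rightarrow> (real \<Rightarrow> real) \<Rightarrow> bool" where
  "linear_form_on S g \<longleftrightarrow> (\<exists>a b. \<forall>s\<in>S. g s = a * s + b)"

definition contractive_homeomorphism :: "real set \<Rightarrow> real set \<Rightarrow> (real \<Rightarrow> real) \<Rightarrow> bool" where
  "contractive_homeomorphism S S' h \<longleftrightarrow>
     (\<exists>h'. homeomorphism S S' h h') \<and> (\<exists>c<1. c-lipschitz_on S h)"

text \<open>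
  A function on \<open>I = [t 0, t N]\<close> is represented by the function on the whole type that is
  \<open>undefined\<close> off \<open>I\<close>, so that equality of representatives is equality on \<open>I\<close>.
\<close>

definition interpolation_space :: "nat \<Rightarrow> (nat \<Rightarrow> real) \<Rightarrow> (nat \<Rightarrow> real) \<Rightarrow> (real \<Rightarrow> real) set" where
  "interpolation_space N t x =
     {f \<in> extensional {t 0..t N}. continuous_on {t 0..t N} f \<and> f (t 0) = x 0 \<and> f (t N) = x N}"

text \<open>
  An interior node \<open>t n\<close> lies in two of the subintervals; the operator below uses the left one.
  On \<open>interpolation_space\<close> the choice is immaterial: under the end point conditions both
  subintervals give the value \<open>x n\<close>.
\<close>

definition fif_operator ::
  "nat \<Rightarrow> (nat \<Rightarrow> real) \<Rightarrow> (nat \<Rightarrow> real \<Rightarrow> real) \<Rightarrow> (nat \<Rightarrow> real \<Rightarrow> real \<Rightarrow> real) \<Rightarrow>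
    (real \<Rightarrow> real) \<Rightarrow> (real \<Rightarrow> real)" where
  "fif_operator N t L F f =
     (\<lambda>s\<in>{t 0..t N}.
        let n = (LEAST n. n \<in> {1..N} \<and> s \<in> {t (n - 1)..t n});
            u = inv_into {t 0..t N} (L n) s
        in F n u (f u))"

definition fractal_interpolation_function ::
  "nat \<Rightarrow> (nat \<Rightarrow> real) \<Rightarrow> (nat \<Rightarrow> real) \<Rightarrow> (nat \<Rightarrow> real \<Rightarrow> real) \<Rightarrow>
    (nat \<Rightarrow> real \<Rightarrow> real \<Rightarrow> real) \<Rightarrow> (real \<Rightarrow> real)" where
  "fractal_interpolation_function N t x L F =
     (THE f. f \<in> interpolation_space N t x \<and> fif_operator N t L F f = f)"

definition piecewise_linear_through ::
  "nat \<Rightarrow> (nat \<Rightarrow> real) \<Rightarrow> (nat \<Rightarrow> real) \<Rightarrow> (real \<Rightarrow> real) \<Rightarrow> bool" where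
  "piecewise_linear_through N t x g \<longleftrightarrow>
     continuous_on {t 0..t N} g \<and>
     (\<forall>n\<in>{1..N}. linear_form_on {t (n - 1)..t n} g) \<and>
     (\<forall>n\<in>{0..N}. g (t n) = x n)"

end

theory Submission
  imports Defs
begin

text \<open>
  The operator contracts the supremum metric by the factor \<open>max \<bar>\<alpha> n\<bar> < 1\<close>, so Banach's theorem
  makes the fractal interpolation function a genuine fixed point, i.e.
  \<open>f (L n u) = \<alpha> n * f u + q n u\<close> for \<open>u\<close> in \<open>I\<close>.
  Since \<open>L n\<close> is affine, \<open>q n\<close> and \<open>\<lambda>u. g\<^sub>0 (L n u) - \<alpha> n * r u\<close> are affine functions on \<open>I\<close>; by the
  end point conditions they agree at \<open>t 0\<close> and \<open>t N\<close>, hence everywhere on \<open>I\<close>. Both claims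
  follow with \<open>s = L n u\<close>.
\<close>

section \<open>Affine functions on a set of reals\<close>

lemma linear_form_on_eqI:
  assumes "linear_form_on S g" "linear_form_on S h"
    and "a \<in> S" "b \<in> S" "a \<noteq> b" "g a = h a" "g b = h b" "s \<in> S"
  shows "g s = h s"
proof -
  obtain k l where g: "\<And>s. s \<in> S \<Longrightarrow> g s = k * s + l"
    using assms(1) by (auto simp: linear_form_on_def)
  obtain k' l' where h: "\<And>s. s \<in> S \<Longrightarrow> h s = k' * s + l'"
    using assms(2) by (auto simp: linear_form_on_def)
  have eqs: "k * a + l = k' * a + l'" "k * b + l = k' * b + l'"
    using assms g h by metis+
  then have "(k - k') * (a - b) = 0" by (simp add: algebra_simps)
  then have "k = k'" using \<open>a \<noteq> b\<close> by simp
  then show ?thesis using eqs g h \<open>s \<in> S\<close> by simp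
qed

lemma linear_form_on_compose:
  assumes "linear_form_on S h" "linear_form_on S' g" "h ` S \<subseteq> S'"
  shows "linear_form_on S (\<lambda>s. g (h s))"
proof -
  obtain k l where h: "\<And>s. s \<in> S \<Longrightarrow> h s = k * s + l"
    using assms(1) by (auto simp: linear_form_on_def)
  obtain k' l' where g: "\<And>s. s \<in> S' \<Longrightarrow> g s = k' * s + l'"
    using assms(2) by (auto simp: linear_form_on_def)
  have "g (h s) = (k' * k) * s + (k' * l + l')" if "s \<in> S" for s
    using that g[of "h s"] h[of s] assms(3) by (auto simp: algebra_simps)
  then show ?thesis unfolding linear_form_on_def by blast
qed

lemma linear_form_on_diff_scaled:
  assumes "linear_form_on S g" "linear_form_on S h"
  shows "linear_form_on S (\<lambda>s. g s - c * h s)"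
proof -
  obtain k l where g: "\<And>s. s \<in> S \<Longrightarrow> g s = k * s + l"
    using assms(1) by (auto simp: linear_form_on_def)
  obtain k' l' where h: "\<And>s. s \<in> S \<Longrightarrow> h s = k' * s + l'"
    using assms(2) by (auto simp: linear_form_on_def)
  have "g s - c * h s = (k - c * k') * s + (l - c * l')" if "s \<in> S" for s
    using that g h by (auto simp: algebra_simps)
  then show ?thesis unfolding linear_form_on_def by blast
qed

text \<open>The least \<open>n\<close> with \<open>n \<ge> 1\<close> and \<open>s \<le> t n\<close>
  works: minimality forces \<open>t (n - 1) < s\<close>, except for \<open>n = 1\<close>, where
  \<open>s \<ge> t 0\<close> is the lower bound of the whole interval.\<close>

lemma nodes_cover:
  fixes t :: "nat \<Rightarrow> real"
  assumes "s \<in> {t 0..t N}" "N \<ge> 1"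
  obtains n where "n \<in> {1..N}" "s \<in> {t (n - 1)..t n}"
proof -
  let ?P = "\<lambda>n. n \<ge> 1 \<and> s \<le> t n"
  define n where "n = (LEAST n. ?P n)"
  have n: "?P n"
    using LeastI[of ?P N] assms by (auto simp: n_def)
  have "n \<le> N" using assms unfolding n_def by (intro Least_le) auto
  moreover have "t (n - 1) \<le> s"
  proof (cases "n = 1")
    case False
    then have "n - 1 < n" "n - 1 \<ge> 1" using n by auto
    moreover from this have "\<not> ?P (n - 1)" using not_less_Least[of "n - 1" ?P] n_def by blast
    ultimately show ?thesis by auto
  qed (use assms in simp)
  ultimately show ?thesis using that n by auto
qed

section \<open>Banach's theorem for interpolating functions\<close>

text \<open>The contraction principle is applied in the complete metric space of bounded continuous
  functions on the whole line, with \<open>T\<close> transported there by restriction and extension.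
  The premise \<open>contr\<close> expresses contraction in the supremum metric through pointwise
  bounds \<open>d\<close>, so no supremum has to be formed.\<close>

lemma Banach_fix_interpolation_space:
  assumes less: "t 0 < t N" and c: "0 \<le> c" "c < 1"
    and T: "T \<in> interpolation_space N t x \<rightarrow> interpolation_space N t x"
    and contr: "\<And>f g d s. f \<in> interpolation_space N t x \<Longrightarrow> g \<in> interpolation_space N t x \<Longrightarrow>
      (\<And>u. u \<in> {t 0..t N} \<Longrightarrow> \<bar>f u - g u\<bar> \<le> d) \<Longrightarrow> s \<in> {t 0..t N} \<Longrightarrow> \<bar>T f s - T g s\<bar> \<le> c * d"
  shows "\<exists>!f. f \<in> interpolation_space N t x \<and> T f = f"
proof -
  let ?I = "{t 0..t N}" and ?X = "interpolation_space N t x"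
  \<comment> \<open>Only the two end point values are prescribed; behaviour off the interval is
    free. Writing the set as \<open>PiC\<close> makes its closedness, hence completeness,
    immediate.\<close>
  define S :: "(real \<Rightarrow>\<^sub>C real) set"
    where "S = PiC {t 0, t N} (\<lambda>s. if s = t 0 then {x 0} else {x N})"
  define res :: "(real \<Rightarrow>\<^sub>C real) \<Rightarrow> real \<Rightarrow> real" where "res h = restrict h ?I" for h
  have in_S: "h \<in> S \<longleftrightarrow> h (t 0) = x 0 \<and> h (t N) = x N" for h
    using less by (auto simp: S_def mem_PiC_iff Pi_iff)
  have res_X: "res h \<in> ?X" if "h \<in> S" for h
  proof -
    have "continuous_on ?I (res h)"
      by (subst continuous_on_cong[OF refl, of _ _ h]) (auto simp: res_def)
    then show ?thesis
      using that less by (simp add: interpolation_space_def in_S) (simp add: res_def)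
  qed
  \<comment> \<open>Each \<open>f\<close> is extended by its end point values: \<open>clamp\<close>
    sends a real number to the nearest point of the interval.\<close>
  have "\<exists>h. \<forall>s. apply_bcontfun h s = f (clamp (t 0) (t N) s)" if "f \<in> ?X" for f
    using that continuous_on_cbox_bcontfunE[of "t 0" "t N" f]
    by (auto simp: interpolation_space_def)
  then obtain ext where ext: "\<And>f s. f \<in> ?X \<Longrightarrow> apply_bcontfun (ext f) s = f (clamp (t 0) (t N) s)"
    by metis
  have clamp_in: "clamp (t 0) (t N) s \<in> ?I" for s
    using clamp_in_interval[of "t 0" "t N" s] less by simp
  have clamp_id: "clamp (t 0) (t N) s = s" if "s \<in> ?I" for s
    using clamp_cancel_cbox[of s "t 0" "t N"] that by simp
  have ext_S: "ext f \<in> S" if "f \<in> ?X" for f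
    using that less by (simp add: in_S ext clamp_id) (simp add: interpolation_space_def)
  have res_ext: "res (ext f) = f" if "f \<in> ?X" for f
  proof
    fix s show "res (ext f) s = f s"
      using that by (cases "s \<in> ?I")
        (auto simp: res_def ext clamp_id interpolation_space_def extensional_def)
  qed
  have TX: "T f \<in> ?X" if "f \<in> ?X" for f using T that by blast
  \<comment> \<open>Since \<open>res (ext f) = f\<close>, the maps \<open>res\<close> and
    \<open>ext\<close> carry fixed points of this conjugated map to fixed points of \<open>T\<close>
    and back.\<close>
  have "\<exists>!h\<in>S. ext (T (res h)) = h"
  proof (rule Banach_fix[OF _ _ c])
    show "complete S"
      unfolding S_def complete_eq_closed by (rule closed_PiC) auto
    \<comment> \<open>The chord joining the two end points, extended to a bounded continuous
      function, shows that \<open>S\<close> is nonempty.\<close>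
    define g where "g s = x 0 + (s - t 0) / (t N - t 0) * (x N - x 0)" for s
    have "continuous_on (cbox (t 0) (t N)) g"
      using less unfolding g_def by (intro continuous_intros) auto
    then obtain k :: "real \<Rightarrow>\<^sub>C real" where "\<And>s. s \<in> cbox (t 0) (t N) \<Longrightarrow> k s = g s"
      by (rule continuous_on_cbox_bcontfunE) (rule that)
    then have "k \<in> S" using less by (simp add: in_S g_def)
    then show "S \<noteq> {}" by auto
    show "(\<lambda>h. ext (T (res h))) ` S \<subseteq> S"
      using ext_S TX res_X by auto
    fix h k assume hk: "h \<in> S" "k \<in> S"
    show "dist (ext (T (res h))) (ext (T (res k))) \<le> c * dist h k"
    proof (rule dist_bound)
      \<comment> \<open>Every value of an extension is a value at a clamped point, so the bound on
        the interval with \<open>d = dist h k\<close> gives the bound on the whole line.\<close>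
      fix s
      have "\<bar>res h u - res k u\<bar> \<le> dist h k" if "u \<in> ?I" for u
        using dist_bounded[of h u k] that by (simp add: res_def dist_real_def)
      then show "dist (ext (T (res h)) s) (ext (T (res k)) s) \<le> c * dist h k"
        using contr[OF res_X[OF hk(1)] res_X[OF hk(2)] _ clamp_in] hk
        by (simp add: ext TX res_X dist_real_def)
    qed
  qed
  then obtain h where h: "h \<in> S" "ext (T (res h)) = h"
    and uniq: "\<And>k. k \<in> S \<Longrightarrow> ext (T (res k)) = k \<Longrightarrow> k = h"
    by (elim ex1E conjE) blast
  show ?thesis
  proof
    show "res h \<in> ?X \<and> T (res h) = res h"
      using h res_X res_ext TX by metis
  next
    fix f assume "f \<in> ?X \<and> T f = f"
    then show "f = res h" using uniq[of "ext f"] ext_S res_ext by metis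
  qed
qed

section \<open>The fixed-point operator of an iterated function system\<close>

text \<open>The setting for the fixed-point theory: the \<open>F n\<close> are jointly continuous
  and share one contraction factor \<open>c\<close> in the second variable. Affine formulas enter
  only in the final theorem.\<close>

locale interpolation_ifs =
  fixes N :: nat and t x :: "nat \<Rightarrow> real"
    and L :: "nat \<Rightarrow> real \<Rightarrow> real" and F :: "nat \<Rightarrow> real \<Rightarrow> real \<Rightarrow> real" and c :: real
  assumes N: "N \<ge> 1"
    and mono: "strict_mono_on {0..N} t"
    and homeo: "\<And>n. n \<in> {1..N} \<Longrightarrow> \<exists>L'. homeomorphism {t 0..t N} {t (n - 1)..t n} (L n) L'"
    and L_left: "\<And>n. n \<in> {1..N} \<Longrightarrow> L n (t 0) = t (n - 1)"
    and L_right: "\<And>n. n \<in> {1..N} \<Longrightarrow> L n (t N) = t n"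
    and F_cont: "\<And>n. n \<in> {1..N} \<Longrightarrow> continuous_on ({t 0..t N} \<times> UNIV) (\<lambda>(u, y). F n u y)"
    and c: "0 \<le> c" "c < 1"
    and F_contr: "\<And>n u y z. n \<in> {1..N} \<Longrightarrow> u \<in> {t 0..t N} \<Longrightarrow> \<bar>F n u y - F n u z\<bar> \<le> c * \<bar>y - z\<bar>"
    and F_left: "\<And>n. n \<in> {1..N} \<Longrightarrow> F n (t 0) (x 0) = x (n - 1)"
    and F_right: "\<And>n. n \<in> {1..N} \<Longrightarrow> F n (t N) (x N) = x n"
begin

abbreviation "I \<equiv> {t 0..t N}"
abbreviation "X \<equiv> interpolation_space N t x"
abbreviation "T \<equiv> fif_operator N t L F"
abbreviation "L_inv n \<equiv> inv_into I (L n)"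

lemma nodes_less: "i < j \<Longrightarrow> j \<le> N \<Longrightarrow> t i < t j"
  using mono by (auto simp: strict_mono_on_def)

lemma nodes_le: "i \<le> j \<Longrightarrow> j \<le> N \<Longrightarrow> t i \<le> t j"
  using nodes_less[of i j] by (cases "i = j") auto

lemma nodes_mem: "i \<le> N \<Longrightarrow> t i \<in> I"
  using nodes_le by auto

lemma subinterval_subset: "n \<in> {1..N} \<Longrightarrow> {t (n - 1)..t n} \<subseteq> I"
  using nodes_le[of 0 "n - 1"] nodes_le[of n N] by auto

lemma L_image: "n \<in> {1..N} \<Longrightarrow> L n ` I = {t (n - 1)..t n}"
  using homeo[of n] by (auto simp: homeomorphism_def)

lemma L_inj: "n \<in> {1..N} \<Longrightarrow> inj_on (L n) I"
  using homeo[of n] by (auto simp: homeomorphism_def intro: inj_on_inverseI)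

lemma L_inv_mem: "n \<in> {1..N} \<Longrightarrow> s \<in> {t (n - 1)..t n} \<Longrightarrow> L_inv n s \<in> I"
  using inv_into_into[of s "L n" I] L_image[of n] by simp

lemma L_L_inv: "n \<in> {1..N} \<Longrightarrow> s \<in> {t (n - 1)..t n} \<Longrightarrow> L n (L_inv n s) = s"
  using f_inv_into_f[of s "L n" I] L_image[of n] by simp

lemma L_inv_left: "n \<in> {1..N} \<Longrightarrow> L_inv n (t (n - 1)) = t 0"
  using inv_into_f_f[OF L_inj nodes_mem[of 0]] L_left by (metis le0)

lemma L_inv_right: "n \<in> {1..N} \<Longrightarrow> L_inv n (t n) = t N"
  using inv_into_f_f[OF L_inj nodes_mem[of N]] L_right by (metis order_refl)

text \<open>The continuous inverse supplied by the homeomorphism agrees with \<open>inv_into\<close>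
  on the subinterval, so continuity passes over.\<close>

lemma L_inv_cont:
  assumes n: "n \<in> {1..N}"
  shows "continuous_on {t (n - 1)..t n} (L_inv n)"
proof -
  obtain L' where L': "homeomorphism I {t (n - 1)..t n} (L n) L'"
    using homeo[OF n] by blast
  have "L' s = L_inv n s" if "s \<in> {t (n - 1)..t n}" for s
    using that L' L_inv_mem[OF n that] L_L_inv[OF n that] by (metis homeomorphism_apply1)
  with homeomorphism_cont2[OF L'] show ?thesis
    by (rule continuous_on_eq)
qed

text \<open>This removes the \<open>LEAST\<close> from the operator: any subinterval containing
  \<open>s\<close> may be used, which is what gluing at the nodes requires.\<close>

lemma fif_operator_on_subinterval:
  assumes f: "f \<in> X" and n: "n \<in> {1..N}" and s: "s \<in> {t (n - 1)..t n}"
  shows "T f s = F n (L_inv n s) (f (L_inv n s))"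
proof -
  let ?P = "\<lambda>n. n \<in> {1..N} \<and> s \<in> {t (n - 1)..t n}"
  define m where "m = (LEAST n. ?P n)"
  have m: "m \<in> {1..N}" "s \<in> {t (m - 1)..t m}"
    using LeastI[of ?P n] n s by (auto simp: m_def)
  have "m \<le> n" unfolding m_def using n s by (intro Least_le) auto
  have T: "T f s = F m (L_inv m s) (f (L_inv m s))"
    using s subinterval_subset[OF n] by (auto simp: fif_operator_def Let_def m_def)
  show ?thesis
  proof (cases "m = n")
    \<comment> \<open>Here \<open>m < n\<close>, while \<open>t (n - 1) \<le> s \<le> t m\<close>;
      strict monotonicity leaves only the shared node \<open>s = t m\<close> with
      \<open>m = n - 1\<close>. Its preimages are \<open>t N\<close> under \<open>L m\<close> and
      \<open>t 0\<close> under \<open>L n\<close>, and both branches give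
      \<open>x m\<close>.\<close>
    case False
    then have "m \<le> n - 1" "n - 1 \<le> N" using \<open>m \<le> n\<close> n by auto
    moreover have "\<not> t m < t (n - 1)" using m s by auto
    ultimately have "m = n - 1" using nodes_less[of m "n - 1"] le_neq_implies_less[of m "n - 1"] by blast
    then have st: "s = t m" "s = t (n - 1)" using m s by auto
    have ends: "f (t 0) = x 0" "f (t N) = x N"
      using f by (auto simp: interpolation_space_def)
    have "L_inv m s = t N" "L_inv n s = t 0"
      using L_inv_right[OF m(1)] L_inv_left[OF n] st by auto
    then show ?thesis
      using T F_right[OF m(1)] F_left[OF n] ends \<open>m = n - 1\<close> by simp
  qed (use T in simp)
qed

text \<open>On each closed subinterval the image is a composition of continuous maps; finitely many
  such pieces glue. The end point values come from the first and the last subinterval.\<close>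

lemma fif_operator_closed:
  assumes f: "f \<in> X"
  shows "T f \<in> X"
proof -
  have ends: "f (t 0) = x 0" "f (t N) = x N" and f_cont: "continuous_on I f"
    using f by (auto simp: interpolation_space_def)
  have "continuous_on {t (n - 1)..t n} (T f)" if n: "n \<in> {1..N}" for n
  proof -
    have "continuous_on {t (n - 1)..t n} (\<lambda>s. (\<lambda>(u, y). F n u y) (L_inv n s, f (L_inv n s)))"
      using n L_inv_mem
      by (intro continuous_on_compose2[OF F_cont] continuous_on_Pair L_inv_cont
          continuous_on_compose2[OF f_cont]) auto
    then show ?thesis
      by (rule continuous_on_eq) (simp only: fif_operator_on_subinterval[OF f n] case_prod_conv)
  qed
  then have "continuous_on (\<Union>n\<in>{1..N}. {t (n - 1)..t n}) (T f)"
    by (rule continuous_on_closed_Union[OF finite_atLeastAtMost closed_atLeastAtMost])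
  moreover have "s \<in> (\<Union>n\<in>{1..N}. {t (n - 1)..t n})" if "s \<in> I" for s
    by (rule nodes_cover[OF that N]) (rule UN_I)
  ultimately have "continuous_on I (T f)"
    by (rule continuous_on_subset[OF _ subsetI])
  moreover have "T f (t 0) = x 0"
    using fif_operator_on_subinterval[OF f, of 1 "t 0"] L_inv_left[of 1] F_left[of 1] N ends
      nodes_le[of 0 1] by simp
  moreover have "T f (t N) = x N"
    using fif_operator_on_subinterval[OF f, of N "t N"] L_inv_right[of N] F_right[of N] N ends
      nodes_le[of "N - 1" N] by simp
  moreover have "T f \<in> extensional I" by (simp add: fif_operator_def)
  ultimately show ?thesis by (simp add: interpolation_space_def)
qed

text \<open>Both images at \<open>s\<close> come from the same \<open>F n\<close> at the same first
  argument, so only the second arguments differ.\<close>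

lemma fif_operator_contraction:
  assumes f: "f \<in> X" and g: "g \<in> X" and d: "\<And>u. u \<in> I \<Longrightarrow> \<bar>f u - g u\<bar> \<le> d" and s: "s \<in> I"
  shows "\<bar>T f s - T g s\<bar> \<le> c * d"
proof -
  obtain n where n: "n \<in> {1..N}" "s \<in> {t (n - 1)..t n}"
    using nodes_cover[OF s N] .
  let ?u = "L_inv n s"
  have "\<bar>T f s - T g s\<bar> \<le> c * \<bar>f ?u - g ?u\<bar>"
    using F_contr[OF n(1) L_inv_mem[OF n]] fif_operator_on_subinterval[OF _ n] f g by simp
  also have "\<dots> \<le> c * d"
    using d[OF L_inv_mem[OF n]] c by (intro mult_left_mono) auto
  finally show ?thesis .
qed

text \<open>Unique existence makes the definite description \<open>THE\<close> meaningful, so its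
  defining properties become available.\<close>

theorem fif_fixed_point:
  defines "f \<equiv> fractal_interpolation_function N t x L F"
  shows "f \<in> X" "T f = f"
proof -
  have "\<exists>!f. f \<in> X \<and> T f = f"
    using nodes_less[of 0 N] N c fif_operator_closed fif_operator_contraction
    by (intro Banach_fix_interpolation_space[where c = c]) auto
  from theI'[OF this] show "f \<in> X" "T f = f"
    by (auto simp: f_def fractal_interpolation_function_def)
qed

lemma fif_on_subinterval:
  assumes "n \<in> {1..N}" "s \<in> {t (n - 1)..t n}"
  defines "f \<equiv> fractal_interpolation_function N t x L F"
  shows "f s = F n (L_inv n s) (f (L_inv n s))"
  using fif_operator_on_subinterval[OF _ assms(1,2), of f] fif_fixed_point by (simp add: f_def)

end

section \<open>The recursive relation for affine data\<close>

theorem theorem5p1: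
  fixes N :: nat
    and t x :: "nat \<Rightarrow> real"
    and L :: "nat \<Rightarrow> real \<Rightarrow> real"
    and F :: "nat \<Rightarrow> real \<Rightarrow> real \<Rightarrow> real"
    and q :: "nat \<Rightarrow> real \<Rightarrow> real"
    and \<alpha> q1 q0 :: "nat \<Rightarrow> real"
    and f g\<^sub>0 r :: "real \<Rightarrow> real"
  assumes "N \<ge> 2"
    and "strict_mono_on {0..N} t"
    and "\<And>n. n \<in> {1..N} \<Longrightarrow> contractive_homeomorphism {t 0..t N} {t (n - 1)..t n} (L n)"
    and "\<And>n. n \<in> {1..N} \<Longrightarrow> linear_form_on {t 0..t N} (L n)"
    and "\<And>n. n \<in> {1..N} \<Longrightarrow> L n (t 0) = t (n - 1)"
    and "\<And>n. n \<in> {1..N} \<Longrightarrow> L n (t N) = t n"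
    and "\<And>n. n \<in> {1..N} \<Longrightarrow> \<alpha> n \<in> {-1<..<1}"
    and "\<And>n s. n \<in> {1..N} \<Longrightarrow> s \<in> {t 0..t N} \<Longrightarrow> q n s = q1 n * s + q0 n"
    and "\<And>n s y. n \<in> {1..N} \<Longrightarrow> s \<in> {t 0..t N} \<Longrightarrow> F n s y = \<alpha> n * y + q n s"
    and "\<And>n. n \<in> {1..N} \<Longrightarrow> F n (t 0) (x 0) = x (n - 1)"
    and "\<And>n. n \<in> {1..N} \<Longrightarrow> F n (t N) (x N) = x n"
    and "f = fractal_interpolation_function N t x L F"
    and "piecewise_linear_through N t x g\<^sub>0"
    and "linear_form_on UNIV r" and "r (t 0) = x 0" and "r (t N) = x N"
  shows "(\<forall>n\<in>{1..N}. \<forall>s\<in>{t (n - 1)..t n}.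
            f s = g\<^sub>0 s + \<alpha> n * ((\<lambda>u. f u - r u) \<circ> inv_into {t 0..t N} (L n)) s) \<and>
         (\<forall>n\<in>{1..N}. \<forall>s\<in>{t (n - 1)..t n}.
            (q n \<circ> inv_into {t 0..t N} (L n)) s
              = g\<^sub>0 s - \<alpha> n * (r \<circ> inv_into {t 0..t N} (L n)) s)"
proof -
  let ?I = "{t 0..t N}"
  \<comment> \<open>The maximum over the finite nonempty index set is attained at some
    \<open>k\<close>, so \<open>c = \<bar>\<alpha> k\<bar>\<close> is strictly below 1.\<close>
  define c where "c = Max ((\<lambda>n. \<bar>\<alpha> n\<bar>) ` {1..N})"
  have \<alpha>_le: "\<bar>\<alpha> n\<bar> \<le> c" if "n \<in> {1..N}" for n
    using that by (auto simp: c_def)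
  have "c \<in> (\<lambda>n. \<bar>\<alpha> n\<bar>) ` {1..N}"
    unfolding c_def using \<open>N \<ge> 2\<close> by (intro Max_in) auto
  then obtain k where k: "k \<in> {1..N}" "c = \<bar>\<alpha> k\<bar>" by auto
  interpret interpolation_ifs N t x L F c
  proof
    show "N \<ge> 1" "strict_mono_on {0..N} t" using assms(1,2) by auto
    show "0 \<le> c" "c < 1" using k assms(7)[OF k(1)] by auto
    fix n assume n: "n \<in> {1..N}"
    show "\<exists>L'. homeomorphism ?I {t (n - 1)..t n} (L n) L'"
      using assms(3)[OF n] by (auto simp: contractive_homeomorphism_def)
    show "L n (t 0) = t (n - 1)" "L n (t N) = t n"
      "F n (t 0) (x 0) = x (n - 1)" "F n (t N) (x N) = x n"
      using assms(5,6,10,11) n by auto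
    have "continuous_on (?I \<times> UNIV) (\<lambda>p. \<alpha> n * snd p + (q1 n * fst p + q0 n))"
      by (intro continuous_intros)
    then show "continuous_on (?I \<times> UNIV) (\<lambda>(u, y). F n u y)"
      by (rule continuous_on_eq) (use assms(8,9)[OF n] in auto)
    fix u y z assume u: "u \<in> ?I"
    have "\<bar>F n u y - F n u z\<bar> = \<bar>\<alpha> n\<bar> * \<bar>y - z\<bar>"
      using assms(9)[OF n u] by (simp add: abs_mult[symmetric] algebra_simps)
    also have "\<dots> \<le> c * \<bar>y - z\<bar>"
      using \<alpha>_le[OF n] by (intro mult_right_mono) auto
    finally show "\<bar>F n u y - F n u z\<bar> \<le> c * \<bar>y - z\<bar>" .
  qed
  have ends: "t 0 \<in> ?I" "t N \<in> ?I" "t 0 \<noteq> t N"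
    using nodes_mem[of 0] nodes_mem[of N] nodes_less[of 0 N] assms(1) by auto
  \<comment> \<open>Pulling the second claim back along \<open>L n\<close> places both sides on the
    whole interval, where two nodes suffice to compare affine functions.\<close>
  have q_eq: "q n u = g\<^sub>0 (L n u) - \<alpha> n * r u" if n: "n \<in> {1..N}" and u: "u \<in> ?I" for n u
  proof (rule linear_form_on_eqI[OF _ _ ends _ _ u])
    show "linear_form_on ?I (q n)"
      using assms(8)[OF n] unfolding linear_form_on_def by blast
    have "linear_form_on {t (n - 1)..t n} g\<^sub>0"
      using assms(13) n unfolding piecewise_linear_through_def by blast
    \<comment> \<open>\<open>L n\<close> maps into a single subinterval, on which
      \<open>g\<^sub>0\<close> has one affine formula; composition with the affine
      \<open>L n\<close> stays affine.\<close>
    then have "linear_form_on ?I (\<lambda>u. g\<^sub>0 (L n u))"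
      by (rule linear_form_on_compose[OF assms(4)[OF n]]) (simp only: L_image[OF n] order_refl)
    moreover have "linear_form_on ?I r"
      using assms(14) unfolding linear_form_on_def by blast
    ultimately show "linear_form_on ?I (\<lambda>u. g\<^sub>0 (L n u) - \<alpha> n * r u)"
      by (rule linear_form_on_diff_scaled)
    have "g\<^sub>0 (t (n - 1)) = x (n - 1)" "g\<^sub>0 (t n) = x n"
      using assms(13) n by (auto simp: piecewise_linear_through_def)
    then show "q n (t 0) = g\<^sub>0 (L n (t 0)) - \<alpha> n * r (t 0)"
      "q n (t N) = g\<^sub>0 (L n (t N)) - \<alpha> n * r (t N)"
      using assms(9)[OF n ends(1), of "x 0"] assms(9)[OF n ends(2), of "x N"]
        F_left[OF n] F_right[OF n] L_left[OF n] L_right[OF n] assms(15,16) by auto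
  qed
  have q_inv: "q n (L_inv n s) = g\<^sub>0 s - \<alpha> n * r (L_inv n s)"
    if "n \<in> {1..N}" "s \<in> {t (n - 1)..t n}" for n s
    using q_eq[OF that(1) L_inv_mem[OF that]] L_L_inv[OF that] by simp
  \<comment> \<open>The fixed-point equation reads
    \<open>f s = \<alpha> n * f (L_inv n s) + q n (L_inv n s)\<close>; substituting
    \<open>q_inv\<close> gives the recursion.\<close>
  have "f s = g\<^sub>0 s + \<alpha> n * (f (L_inv n s) - r (L_inv n s))"
    if "n \<in> {1..N}" "s \<in> {t (n - 1)..t n}" for n s
    using fif_on_subinterval[OF that] assms(9)[OF that(1) L_inv_mem[OF that]] q_inv[OF that]
    by (simp add: assms(12) algebra_simps)
  then show ?thesis using q_inv by simp
qed

end
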